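(* Let $k\ge 1$ be an integer and $\epsilon>0$. Let $A$ be any deterministic online algorithm for the $k$-Canadian Traveller Problem with predictions such that, on every instance whose prediction is correct (error $0$), $A$ has competitive ratio smaller than $1+\epsilon$ (i.e. $ALG<(1+\epsilon)\,OPT$). Then there exists an instance whose prediction is not correct, whose prediction error is at most $2$, and whose graph is path-disjoint, on which $ALG\ge \left(2k-1+\frac{4k}{\epsilon}\right)OPT$.
   Context: $k$-Canadian Traveller Problem ($k$-CTP) with predictions: an instance consists of a connected undirected graph $G=(V,E)$, a source $s\in V$, a destination $t\in V$, a nonnegative cost function $c:E\to\mathbb{R}^+$, an unknown set $B\subseteq E$ of blocked edges with $|B|\le k$ such that $G-B$ still contains an $s$-$t$ path, and a predicted set $B_p\subseteq E$ of blocked edges with $|B_p|\le k$ (every edge is predicted to be either blocked or not). The traveller knows $G$, $c$, $s$, $t$, $k$ and $B_p$ in advance, starts at $s$, moves along edges paying their costs, and learns whether an edge is blocked only upon reaching one of its endpoints; blocked edges cannot be traversed. The goal is to reach $t$. $ALG$ denotes the total cost travelled by the algorithm and $OPT$ the cost of a shortest $s$-$t$ path in $G-B$. The prediction error is $|B\,\triangle\,B_p|$, the number of edges whose prediction is false; the prediction is correct iff the error is $0$. A graph is path-disjoint if all its $s$-$t$ paths are pairwise node-disjoint apart from $s$ and $t$. *)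

theory Defs
  imports Complex_Main "HOL-Library.Infinite_Typeclass"
begin

text \<open>Graphs are finite, simple and undirected; an edge is a two-element set of vertices.
  The record holds what the traveller knows in advance (\<open>k\<close> is a fixed parameter of the
  problem). Values of \<open>cost\<close> outside \<open>edges\<close> are irrelevant.\<close>

record 'v ctp_input =
  verts :: "'v set"
  edges :: "'v set set"
  cost :: "'v set \<Rightarrow> real"
  src :: 'v
  tgt :: 'v
  predicted :: "'v set set"

definition is_walk :: "'v set \<Rightarrow> 'v set set \<Rightarrow> 'v \<Rightarrow> 'v \<Rightarrow> 'v list \<Rightarrow> bool" where
  "is_walk V F u v p \<longleftrightarrow>
     p \<noteq> [] \<and> hd p = u \<and> last p = v \<and> set p \<subseteq> V \<and> successively (\<lambda>x y. {x, y} \<in> F) p"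

definition is_path :: "'v set \<Rightarrow> 'v set set \<Rightarrow> 'v \<Rightarrow> 'v \<Rightarrow> 'v list \<Rightarrow> bool" where
  "is_path V F u v p \<longleftrightarrow> is_walk V F u v p \<and> distinct p"

fun walk_cost :: "('v set \<Rightarrow> real) \<Rightarrow> 'v list \<Rightarrow> real" where
  "walk_cost c (x # y # p) = c {x, y} + walk_cost c (y # p)"
| "walk_cost c _ = 0"

definition graph_connected :: "'v set \<Rightarrow> 'v set set \<Rightarrow> bool" where
  "graph_connected V F \<longleftrightarrow> (\<forall>u\<in>V. \<forall>v\<in>V. \<exists>p. is_path V F u v p)"

definition path_disjoint :: "'v ctp_input \<Rightarrow> bool" where
  "path_disjoint I \<longleftrightarrow>
     (\<forall>p q. is_path (verts I) (edges I) (src I) (tgt I) p \<longrightarrow>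
            is_path (verts I) (edges I) (src I) (tgt I) q \<longrightarrow>
            p \<noteq> q \<longrightarrow> set p \<inter> set q \<subseteq> {src I, tgt I})"

definition ctp_instance :: "nat \<Rightarrow> 'v ctp_input \<Rightarrow> 'v set set \<Rightarrow> bool" where
  "ctp_instance k I B \<longleftrightarrow>
     finite (verts I) \<and>
     (\<forall>e\<in>edges I. e \<subseteq> verts I \<and> card e = 2) \<and>
     graph_connected (verts I) (edges I) \<and>
     src I \<in> verts I \<and> tgt I \<in> verts I \<and>
     (\<forall>e\<in>edges I. 0 \<le> cost I e) \<and>
     B \<subseteq> edges I \<and> card B \<le> k \<and>
     (\<exists>p. is_path (verts I) (edges I - B) (src I) (tgt I) p) \<and>
     predicted I \<subseteq> edges I \<and> card (predicted I) \<le> k"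

definition prediction_error :: "'v ctp_input \<Rightarrow> 'v set set \<Rightarrow> nat" where
  "prediction_error I B = card ((B - predicted I) \<union> (predicted I - B))"

text \<open>On an instance, the set below is finite and nonempty.\<close>

definition OPT :: "'v ctp_input \<Rightarrow> 'v set set \<Rightarrow> real" where
  "OPT I B = Min (walk_cost (cost I) ` {p. is_path (verts I) (edges I - B) (src I) (tgt I) p})"

text \<open>A deterministic online algorithm chooses the next vertex from the input, the walk made so
  far, and the blocked edges discovered so far. All other edges incident to a visited vertex are
  then known to be free, and the time at which each status was learnt can be read off the walk.\<close>

type_synonym 'v ctp_algorithm = "'v ctp_input \<Rightarrow> 'v list \<Rightarrow> 'v set set \<Rightarrow> 'v"

definition discovered :: "'v set set \<Rightarrow> 'v list \<Rightarrow> 'v set set" where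
  "discovered B p = {e \<in> B. e \<inter> set p \<noteq> {}}"

text \<open>The walk made within the first \<open>n\<close> moves; the traveller stops on reaching the target.\<close>

primrec trace :: "'v ctp_algorithm \<Rightarrow> 'v ctp_input \<Rightarrow> 'v set set \<Rightarrow> nat \<Rightarrow> 'v list" where
  "trace A I B 0 = [src I]"
| "trace A I B (Suc n) =
     (let p = trace A I B n in
      if last p = tgt I then p else p @ [A I p (discovered B p)])"

definition solves_ctp :: "nat \<Rightarrow> 'v ctp_algorithm \<Rightarrow> bool" where
  "solves_ctp k A \<longleftrightarrow>
     (\<forall>I B. ctp_instance k I B \<longrightarrow>
        (\<exists>n. is_walk (verts I) (edges I - B) (src I) (tgt I) (trace A I B n)))"

definition ALG :: "'v ctp_algorithm \<Rightarrow> 'v ctp_input \<Rightarrow> 'v set set \<Rightarrow> real" where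
  "ALG A I B = walk_cost (cost I) (trace A I B (LEAST n. last (trace A I B n) = tgt I))"

end

theory Submission
  imports Defs
begin

text \<open>
  The adversary uses \<open>k + 1\<close> internally disjoint two-edge paths from \<open>s\<close> to \<open>t\<close> through hubs:
  the path through \<open>z\<close> costs \<open>2k/\<epsilon>\<close>, the others cost \<open>1\<close>, and all the cost lies on the
  edges at \<open>s\<close>. Consider the blocked sets that leave exactly one hub \<open>j\<close> joined to \<open>t\<close>, and
  compare the run of the algorithm on each of them with the run in which every hub is cut off
  from \<open>t\<close>: the two agree until \<open>j\<close> is reached. Taking for \<open>j\<close> the hub reached last
  in the latter run, the algorithm visits all hubs before it arrives at \<open>t\<close> through \<open>j\<close>, so it
  pays twice the total cost of the hubs minus the cost of \<open>j\<close>. The prediction is that only \<open>z\<close>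
  is joined to \<open>t\<close>. If \<open>j = z\<close>, the prediction is correct and the algorithm pays
  \<open>2k/\<epsilon> + 2k = (1 + \<epsilon>) OPT\<close>, contrary to consistency. Hence \<open>j \<noteq> z\<close>, the error is \<open>2\<close>,
  \<open>OPT = 1\<close> and the algorithm pays \<open>4k/\<epsilon> + 2k - 1\<close>.
\<close>

section \<open>Prefixes, stopping and indistinguishability of runs\<close>

lemma walk_cost_snoc:
  "p \<noteq> [] \<Longrightarrow> walk_cost c (p @ [x]) = walk_cost c p + c {last p, x}"
  by (induction c p rule: walk_cost.induct) auto

lemma trace_nonempty: "trace A I B n \<noteq> []"
  by (induction n) (auto simp: Let_def)

lemma hd_trace: "hd (trace A I B n) = src I"
  by (induction n) (auto simp: Let_def trace_nonempty)

lemma trace_prefix: "m \<le> n \<Longrightarrow> \<exists>q. trace A I B n = trace A I B m @ q"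
proof (induction n rule: dec_induct)
  case (step n)
  then show ?case by (auto simp: Let_def)
qed simp

lemma set_trace_mono: "m \<le> n \<Longrightarrow> set (trace A I B m) \<subseteq> set (trace A I B n)"
  by (metis trace_prefix set_append Un_upper1)

lemma trace_stop:
  assumes "m \<le> n" and "last (trace A I B m) = tgt I"
  shows "trace A I B n = trace A I B m"
  using assms(1)
proof (induction n rule: dec_induct)
  case (step n)
  with assms(2) show ?case by (simp add: Let_def)
qed simp

lemma tgt_notin_butlast_trace: "tgt I \<notin> set (butlast (trace A I B n))"
proof (induction n)
  case (Suc n)
  show ?case
  proof (cases "last (trace A I B n) = tgt I")
    case False
    have "set (trace A I B n) = insert (last (trace A I B n)) (set (butlast (trace A I B n)))"
      by (subst append_butlast_last_id [OF trace_nonempty, symmetric]) simp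
    with False Suc show ?thesis by (auto simp: Let_def)
  qed (use Suc in \<open>simp add: Let_def\<close>)
qed simp

text \<open>A run is constant once it has reached the target, so any such time \<open>n\<close> can
  replace the \<open>LEAST\<close> in \<open>ALG\<close>.\<close>

lemma ALG_eq_walk_cost_trace:
  assumes "last (trace A I B n) = tgt I"
  shows "ALG A I B = walk_cost (cost I) (trace A I B n)"
proof -
  let ?l = "LEAST n. last (trace A I B n) = tgt I"
  have "last (trace A I B ?l) = tgt I" and "?l \<le> n"
    using assms by (auto intro: LeastI Least_le)
  then show ?thesis
    using trace_stop [of ?l n A I B] by (simp add: ALG_def)
qed

text \<open>The algorithm sees only discovered edges, so changing the status of edges not yet
  touched leaves its moves unchanged. The move made after time \<open>n\<close> is still chosen on
  equal information, hence \<open>Suc n\<close>.\<close>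

lemma trace_cong:
  assumes "\<And>e. e \<in> (B - B') \<union> (B' - B) \<Longrightarrow> e \<inter> set (trace A I B n) = {}"
  shows "trace A I B' (Suc n) = trace A I B (Suc n)"
proof -
  have disc: "discovered B' (trace A I B m) = discovered B (trace A I B m)" if "m \<le> n" for m
    using assms set_trace_mono [OF that, of A I B] unfolding discovered_def by blast
  have "m \<le> Suc n \<Longrightarrow> trace A I B' m = trace A I B m" for m
    by (induction m) (auto simp: Let_def disc)
  then show ?thesis by blast
qed

lemma is_walk_prefix_successively:
  assumes "is_walk V F u v (trace A I B n)" and "m \<le> n"
  shows "successively (\<lambda>x y. {x, y} \<in> F) (trace A I B m)"
  using trace_prefix [OF assms(2), of A I B] assms(1)
  by (auto simp: is_walk_def successively_append_iff)

section \<open>The hub graph and its instances\<close>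

locale hub_graph =
  fixes s t :: 'v and M :: "'v set" and w :: "'v \<Rightarrow> real"
  assumes s_neq_t: "s \<noteq> t" and s_notin: "s \<notin> M" and t_notin: "t \<notin> M"
    and finite_M: "finite M" and w_s: "w s = 0" and w_pos: "\<And>x. x \<in> M \<Longrightarrow> 0 < w x"
begin

definition exits :: "'v set \<Rightarrow> 'v set set" where
  "exits X = (\<lambda>x. {x, t}) ` X"

text \<open>Since \<open>w s = 0\<close>, \<open>sum w e\<close> on an edge \<open>e\<close> at
  \<open>s\<close> is just the weight of its hub.\<close>

definition inst :: "'v set \<Rightarrow> 'v ctp_input" where
  "inst P = \<lparr>verts = insert s (insert t M), edges = (\<lambda>x. {s, x}) ` M \<union> exits M,
     cost = (\<lambda>e. if t \<in> e then 0 else sum w e), src = s, tgt = t, predicted = exits P\<rparr>"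

lemma inst_simps [simp]:
  "verts (inst P) = insert s (insert t M)"
  "edges (inst P) = (\<lambda>x. {s, x}) ` M \<union> exits M"
  "cost (inst P) = (\<lambda>e. if t \<in> e then 0 else sum w e)"
  "src (inst P) = s" "tgt (inst P) = t" "predicted (inst P) = exits P"
  by (simp_all add: inst_def)

text \<open>\<open>X = {}\<close> describes the full graph, \<open>X = M - {j}\<close> the graph in
  which only hub \<open>j\<close> is joined to \<open>t\<close>.\<close>

lemma edge_iff:
  assumes "X \<subseteq> M"
  shows "{x, y} \<in> (\<lambda>x. {s, x}) ` M \<union> exits M - exits X \<longleftrightarrow>
    x = s \<and> y \<in> M \<or> y = s \<and> x \<in> M \<or> x = t \<and> y \<in> M - X \<or> y = t \<and> x \<in> M - X"
  using assms s_notin t_notin s_neq_t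
  by (auto simp: exits_def doubleton_eq_iff image_iff)

lemma exits_diff: "X \<subseteq> M \<Longrightarrow> Y \<subseteq> M \<Longrightarrow> exits X - exits Y = exits (X - Y)"
  using t_notin by (auto simp: exits_def doubleton_eq_iff)

lemma card_exits: "X \<subseteq> M \<Longrightarrow> card (exits X) = card X"
  unfolding exits_def using t_notin
  by (intro card_image) (auto simp: inj_on_def doubleton_eq_iff)

text \<open>A hub has no neighbours but \<open>s\<close> and \<open>t\<close>, so a path that enters
  one from \<open>s\<close> must go on to \<open>t\<close> and end there. The case
  \<open>X = {}\<close> gives path-disjointness, the case of one open hub gives
  \<open>OPT\<close>.\<close>

lemma path_iff:
  assumes "X \<subseteq> M"
  shows "is_path (verts (inst P)) (edges (inst P) - exits X) s t p \<longleftrightarrow>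
    (\<exists>x \<in> M - X. p = [s, x, t])" (is "?L \<longleftrightarrow> ?R")
proof
  assume ?L
  then have p: "p \<noteq> []" "hd p = s" "last p = t" "distinct p"
    and succ: "successively (\<lambda>x y. {x, y} \<in> (\<lambda>x. {s, x}) ` M \<union> exits M - exits X) p"
    by (auto simp: is_path_def is_walk_def)
  obtain x q where pq: "p = s # x # q"
    using p s_neq_t by (cases p; cases "tl p") auto
  then have x: "x \<in> M"
    using succ s_neq_t s_notin t_notin edge_iff [OF assms, of s x] by auto
  then obtain y r where q: "q = y # r"
    using p pq t_notin by (cases q) auto
  then have y: "y = t" "x \<in> M - X"
    using succ p x pq t_notin s_notin edge_iff [OF assms, of x y] by auto
  then have "r = []"
    using p pq q by (auto split: if_splits dest: last_in_set)
  then show ?R using y q pq by blast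
next
  assume ?R
  then show ?L
    using s_neq_t s_notin t_notin edge_iff [OF assms]
    by (auto simp: is_path_def is_walk_def)
qed

lemma path_disjoint_inst: "path_disjoint (inst P)"
  using path_iff [of "{}" P] by (auto simp: path_disjoint_def exits_def)

lemma OPT_inst:
  assumes "j \<in> M"
  shows "OPT (inst P) (exits (M - {j})) = w j"
proof -
  have "M - (M - {j}) = {j}" using assms by blast
  then have "{p. is_path (verts (inst P)) (edges (inst P) - exits (M - {j})) s t p} = {[s, j, t]}"
    by (subst path_iff) auto
  moreover have "j \<noteq> s" "j \<noteq> t" using assms s_notin t_notin by auto
  ultimately show ?thesis using s_neq_t w_s by (simp add: OPT_def)
qed

lemma graph_connected_inst:
  assumes "M \<noteq> {}"
  shows "graph_connected (verts (inst P)) (edges (inst P))"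
  unfolding graph_connected_def
proof (intro ballI)
  fix u v
  assume u: "u \<in> verts (inst P)" and v: "v \<in> verts (inst P)"
  obtain m where m: "m \<in> M" using assms by blast
  have E: "{x, y} \<in> edges (inst P) \<longleftrightarrow>
    x = s \<and> y \<in> M \<or> y = s \<and> x \<in> M \<or> x = t \<and> y \<in> M \<or> y = t \<and> x \<in> M" for x y
    using edge_iff [of "{}" x y] by (simp add: exits_def)
  let ?P = "is_path (verts (inst P)) (edges (inst P)) u v"
  consider "u = v" | "{u, v} \<in> edges (inst P)" "u \<noteq> v"
    | "u \<noteq> v" "u \<in> M" "v \<in> M" | "u = s" "v = t" | "u = t" "v = s"
    using u v unfolding E by auto
  then show "\<exists>p. ?P p"
  proof cases
    case 1
    then have "?P [u]" using u by (simp add: is_path_def is_walk_def)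
    then show ?thesis ..
  next
    case 2
    then have "?P [u, v]" using u v by (simp add: is_path_def is_walk_def)
    then show ?thesis ..
  next
    case 3
    then have "?P [u, s, v]"
      unfolding is_path_def is_walk_def successively.simps E using s_notin by auto
    then show ?thesis ..
  next
    case 4
    then have "?P [s, m, t]"
      unfolding is_path_def is_walk_def successively.simps E
      using m s_notin t_notin s_neq_t by auto
    then show ?thesis ..
  next
    case 5
    then have "?P [t, m, s]"
      unfolding is_path_def is_walk_def successively.simps E
      using m s_notin t_notin s_neq_t by auto
    then show ?thesis ..
  qed
qed

text \<open>With \<open>k + 1\<close> hubs, sparing one exit leaves exactly \<open>k\<close> edges,
  the full budget of both the blocked and the predicted set.\<close>

lemma ctp_instance_inst:
  assumes "card M = Suc k" and "z \<in> M" and "j \<in> M"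
  shows "ctp_instance k (inst (M - {z})) (exits (M - {j}))"
proof -
  have "\<exists>p. is_path (verts (inst (M - {z})))
      (edges (inst (M - {z})) - exits (M - {j})) s t p"
    using assms by (subst path_iff) auto
  moreover have "\<forall>e \<in> edges (inst (M - {z})). e \<subseteq> verts (inst (M - {z})) \<and> card e = 2"
    using s_notin t_notin by (auto simp: exits_def card_2_iff)
  moreover have "0 \<le> cost (inst (M - {z})) e" if "e \<in> edges (inst (M - {z}))" for e
    using that w_pos w_s by (auto simp: exits_def less_imp_le intro!: sum_nonneg)
  moreover have "card (exits (M - {x})) \<le> k" if "x \<in> M" for x
    using that assms finite_M by (simp add: card_exits)
  moreover have "exits (M - {x}) \<subseteq> edges (inst (M - {z}))" for x
    by (auto simp: exits_def)
  ultimately show ?thesis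
    using assms finite_M graph_connected_inst unfolding ctp_instance_def by auto
qed

lemma prediction_error_inst:
  assumes "z \<in> M" and "j \<in> M"
  shows "prediction_error (inst (M - {z})) (exits (M - {j})) = (if j = z then 0 else 2)"
proof (cases "j = z")
  case False
  then have "(M - {j}) - (M - {z}) = {z}" "(M - {z}) - (M - {j}) = {j}"
    using assms by auto
  then have "prediction_error (inst (M - {z})) (exits (M - {j})) = card (exits {j, z})"
    by (simp add: prediction_error_def exits_diff) (auto simp: exits_def insert_commute)
  then show ?thesis using False assms by (simp add: card_exits)
qed (simp add: prediction_error_def)

section \<open>Lower bounds on the cost of a run\<close>

text \<open>Every hub visited accounts for a way in and a way out, except that the way out of the
  current position is still to come.\<close>

lemma hub_walk_cost:
  assumes "p \<noteq> []" and "hd p = s" and "t \<notin> set p"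
    and "successively (\<lambda>x y. {x, y} \<in> edges (inst P)) p"
  shows "2 * sum w (set p) - w (last p) \<le> walk_cost (cost (inst P)) p"
  using assms
proof (induction p rule: rev_induct)
  case (snoc y p)
  show ?case
  proof (cases "p = []")
    case False
    define x where "x = last p"
    have xp: "x \<in> set p" using False by (simp add: x_def)
    have edge: "{x, y} \<in> edges (inst P)"
      using snoc.prems False by (simp add: successively_append_iff x_def)
    have xy: "x = s \<and> y \<in> M \<or> y = s \<and> x \<in> M"
      using edge edge_iff [of "{}" x y] snoc.prems(3) xp by (auto simp: exits_def)
    have IH: "2 * sum w (set p) - w x \<le> walk_cost (cost (inst P)) p"
      using snoc False unfolding x_def by (simp add: successively_append_iff)
    \<comment> \<open>One of \<open>x\<close> and \<open>y\<close> is \<open>s\<close>, of weight 0,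
      so the sum is the weight of the hub on the edge.\<close>
    have "walk_cost (cost (inst P)) (p @ [y]) = walk_cost (cost (inst P)) p + (w x + w y)"
      using xy s_notin snoc.prems(3) xp
      by (cases "x = y") (auto simp: walk_cost_snoc [OF False] simp flip: x_def)
    \<comment> \<open>Only an inequality, since a hub visited again adds nothing to the sum.\<close>
    moreover have "2 * sum w (insert y (set p)) \<le> 2 * sum w (set p) + 2 * w y"
      using xy w_pos w_s by (auto simp: sum.insert_if less_imp_le)
    ultimately show ?thesis
      using IH xy w_s by auto
  qed (use snoc.prems w_s in auto)
qed simp

text \<open>The only free edge into \<open>t\<close> comes from \<open>j\<close>.\<close>

lemma walk_visits_open_hub:
  assumes "p \<noteq> []" and "hd p = s" and "j \<notin> set p"
    and "successively (\<lambda>x y. {x, y} \<in> edges (inst P) - exits (M - {j})) p"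
  shows "t \<notin> set p"
  using assms
proof (induction p rule: rev_induct)
  case (snoc y p)
  show ?case
  proof (cases "p = []")
    case False
    then have "{last p, y} \<in> edges (inst P) - exits (M - {j})"
      using snoc.prems by (simp add: successively_append_iff)
    moreover have "last p \<noteq> j" "t \<notin> set p"
      using snoc False by (auto simp: successively_append_iff)
    ultimately show ?thesis
      using edge_iff [of "M - {j}" "last p" y] s_neq_t t_notin False by auto
  qed (use snoc.prems s_neq_t in auto)
qed simp

lemma run_visits_all_hubs:
  assumes "M \<noteq> {}"
    and run: "\<And>j. j \<in> M \<Longrightarrow>
      \<exists>n. is_walk (verts (inst P)) (edges (inst P) - exits (M - {j})) s t
            (trace A (inst P) (exits (M - {j})) n)"
  obtains j n where "j \<in> M" "M \<subseteq> set (trace A (inst P) (exits (M - {j})) n)"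
    "is_walk (verts (inst P)) (edges (inst P) - exits (M - {j})) s t
       (trace A (inst P) (exits (M - {j})) n)"
proof -
  define tr where "tr j = trace A (inst P) (exits (M - {j}))" for j
  \<comment> \<open>This blocked set separates \<open>s\<close> from \<open>t\<close>, so it belongs
    to no instance and \<open>run\<close> says nothing about it. Its run serves only as a common
    reference for the runs \<open>tr j\<close>.\<close>
  define cut where "cut = trace A (inst P) (exits M)"
  define first where "first j = (LEAST n. j \<in> set (tr j n))" for j
  have ex: "\<exists>n. is_walk (verts (inst P)) (edges (inst P) - exits (M - {j})) s t (tr j n) \<and>
      first j \<le> n \<and> j \<in> set (tr j (first j)) \<and> tr j (first j) = cut (first j)" if j: "j \<in> M" for j
  proof -
    obtain n where n: "is_walk (verts (inst P)) (edges (inst P) - exits (M - {j})) s t (tr j n)"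
      using run [OF j] unfolding tr_def by blast
    have no_t: "t \<notin> set (tr j m)" if "m \<le> n" "j \<notin> set (tr j m)" for m
      using that is_walk_prefix_successively [OF n [unfolded tr_def] that(1)]
      by (intro walk_visits_open_hub [where P = P and j = j])
        (auto simp: tr_def trace_nonempty hd_trace)
    have "t \<in> set (tr j n)"
      using n by (auto simp: is_walk_def)
    then have jn: "j \<in> set (tr j n)"
      using no_t by blast
    then have le: "first j \<le> n" and visited: "j \<in> set (tr j (first j))"
      unfolding first_def by (auto intro: Least_le LeastI)
    have "j \<notin> set (tr j 0)"
      using j s_notin by (auto simp: tr_def)
    then obtain m where m: "first j = Suc m"
      using visited by (cases "first j") auto
    then have notin: "j \<notin> set (tr j m)"
      using not_less_Least [of m "\<lambda>n. j \<in> set (tr j n)"] by (simp add: first_def)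
    moreover have "t \<notin> set (tr j m)"
      using no_t notin le m by simp
    \<comment> \<open>Neither endpoint of the one edge that may differ has been visited by time
      \<open>m\<close>, the last moment before \<open>j\<close> is reached.\<close>
    moreover have "exits (M - {j}) - exits M \<union> (exits M - exits (M - {j})) \<subseteq> {{j, t}}"
      by (auto simp: exits_def)
    ultimately have "cut (Suc m) = tr j (Suc m)"
      unfolding cut_def tr_def by (intro trace_cong) auto
    then show ?thesis
      using n le visited m by auto
  qed
  obtain j where j: "j \<in> M" and max: "\<And>i. i \<in> M \<Longrightarrow> first i \<le> first j"
  proof -
    have "Max (first ` M) \<in> first ` M"
      using finite_M assms(1) by (intro Max_in) auto
    then obtain j where "j \<in> M" "first j = Max (first ` M)"
      by auto
    then show ?thesis
      using that finite_M by simp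
  qed
  obtain n where n: "is_walk (verts (inst P)) (edges (inst P) - exits (M - {j})) s t (tr j n)"
      "first j \<le> n" "tr j (first j) = cut (first j)"
    using ex [OF j] by blast
  \<comment> \<open>In \<open>cut\<close>, hub \<open>i\<close> is seen by time
    \<open>first i\<close>, hence by time \<open>first j\<close>, and there \<open>cut\<close>
    agrees with \<open>tr j\<close>.\<close>
  have "i \<in> set (tr j n)" if i: "i \<in> M" for i
  proof -
    have "i \<in> set (cut (first i))"
      using ex [OF i] by auto
    then have "i \<in> set (tr j (first j))"
      using set_trace_mono [OF max [OF i], of A "inst P" "exits M"] n(3)
      by (auto simp: cut_def)
    then show ?thesis
      using set_trace_mono [OF n(2), of A "inst P" "exits (M - {j})"] by (auto simp: tr_def)
  qed
  then show ?thesis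
    using that [OF j] n(1) unfolding tr_def by blast
qed

text \<open>The run enters \<open>t\<close> from \<open>j\<close> at no cost, so
  \<open>hub_walk_cost\<close> applied to the part before that move, which ends at \<open>j\<close>,
  gives the bound.\<close>

lemma ALG_ge_if_visits_all:
  assumes j: "j \<in> M" and all: "M \<subseteq> set (trace A (inst P) (exits (M - {j})) n)"
    and walk: "is_walk (verts (inst P)) (edges (inst P) - exits (M - {j})) s t
      (trace A (inst P) (exits (M - {j})) n)"
  shows "2 * sum w M - w j \<le> ALG A (inst P) (exits (M - {j}))"
proof -
  let ?q = "trace A (inst P) (exits (M - {j})) n"
  define p where "p = butlast ?q"
  have q: "?q = p @ [t]"
    using walk append_butlast_last_id [of ?q] by (auto simp: is_walk_def p_def)
  have p: "p \<noteq> []"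
    using walk q s_neq_t by (cases p) (auto simp: is_walk_def)
  have t: "t \<notin> set p"
    using tgt_notin_butlast_trace [of "inst P"] by (simp add: p_def)
  have succ: "successively (\<lambda>x y. {x, y} \<in> edges (inst P) - exits (M - {j})) p"
    and e: "{last p, t} \<in> edges (inst P) - exits (M - {j})"
    using walk p unfolding q by (auto simp: is_walk_def successively_append_iff)
  have "last p = j"
    using e edge_iff [of "M - {j}" "last p" t] s_neq_t t_notin by auto
  moreover have "hd p = s"
    using walk p unfolding q by (simp add: is_walk_def)
  moreover have "successively (\<lambda>x y. {x, y} \<in> edges (inst P)) p"
    using succ by (rule successively_mono) auto
  ultimately have "2 * sum w (set p) - w j \<le> walk_cost (cost (inst P)) p"
    using hub_walk_cost [OF p _ t] by blast
  moreover have "set p \<subseteq> insert s M"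
    using walk t unfolding q by (auto simp: is_walk_def)
  then have "sum w M \<le> sum w (set p)"
    using all t_notin w_pos w_s finite_M unfolding q
    by (intro sum_mono2) (auto intro: less_imp_le)
  moreover have "ALG A (inst P) (exits (M - {j})) = walk_cost (cost (inst P)) (p @ [t])"
    using ALG_eq_walk_cost_trace [of A "inst P" "exits (M - {j})" n] q by simp
  then have "ALG A (inst P) (exits (M - {j})) = walk_cost (cost (inst P)) p"
    using p by (simp add: walk_cost_snoc)
  ultimately show ?thesis by linarith
qed

end

theorem theorem1:
  fixes A :: "('v :: infinite) ctp_algorithm"
    and k :: nat
    and \<epsilon> :: real
  assumes "1 \<le> k"
    and "0 < \<epsilon>"
    and "solves_ctp k A"
    and "\<And>I B. ctp_instance k I B \<Longrightarrow> prediction_error I B = 0 \<Longrightarrow> 0 < OPT I B \<Longrightarrow>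
           ALG A I B < (1 + \<epsilon>) * OPT I B"
  shows "\<exists>I B. ctp_instance k I B \<and>
           prediction_error I B \<noteq> 0 \<and> prediction_error I B \<le> 2 \<and>
           path_disjoint I \<and>
           0 < OPT I B \<and>
           ALG A I B \<ge> (2 * real k - 1 + 4 * real k / \<epsilon>) * OPT I B"
proof -
  \<comment> \<open>Room for \<open>s\<close>, \<open>t\<close> and \<open>k + 1\<close>
    hubs.\<close>
  obtain S :: "'v set" where S: "finite S" "card S = k + 3"
    using infinite_arbitrarily_large [OF infinite_UNIV] by blast
  obtain s where s: "s \<in> S" using S by fastforce
  have "card (S - {s}) = k + 2" using S s by simp
  then have "S - {s} \<noteq> {}" by (metis card.empty add_is_0 zero_neq_numeral)
  then obtain t where t: "t \<in> S - {s}" by blast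
  define M where "M = S - {s} - {t}"
  have M: "finite M" "card M = Suc k" using S s t by (auto simp: M_def)
  then obtain z where z: "z \<in> M" by fastforce
  \<comment> \<open>The weight of \<open>z\<close> solves \<open>\<epsilon> * w z = 2 * k\<close>:
    then for \<open>j = z\<close> the lower bound \<open>w z + 2 * k\<close> on the cost equals
    \<open>(1 + \<epsilon>) * w z\<close>.\<close>
  define w where "w x = (if x = z then 2 * real k / \<epsilon> else if x \<in> M then 1 else 0)" for x
  interpret hub_graph s t M w
    using M(1) z t assms(1,2) by unfold_locales (auto simp: w_def M_def)
  let ?I = "inst (M - {z})"
  have inst: "ctp_instance k ?I (exits (M - {j}))" if "j \<in> M" for j
    using ctp_instance_inst M z that by blast
  have sum: "sum w M = 2 * real k / \<epsilon> + real k"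
  proof -
    have "sum w M = w z + sum w (M - {z})"
      using M z by (intro sum.remove) auto
    also have "sum w (M - {z}) = sum (\<lambda>_. 1) (M - {z})"
      by (intro sum.cong) (auto simp: w_def)
    also have "\<dots> = real k" using M z by simp
    finally show ?thesis by (simp add: w_def)
  qed
  obtain j n where j: "j \<in> M" and visits: "M \<subseteq> set (trace A ?I (exits (M - {j})) n)"
      "is_walk (verts ?I) (edges ?I - exits (M - {j})) s t (trace A ?I (exits (M - {j})) n)"
  proof (rule run_visits_all_hubs [of "M - {z}" A])
    show "M \<noteq> {}" using z by blast
    show "\<exists>n. is_walk (verts ?I) (edges ?I - exits (M - {j})) s t
        (trace A ?I (exits (M - {j})) n)" if "j \<in> M" for j
      using assms(3) inst [OF that] unfolding solves_ctp_def by fastforce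
  qed
  have cost: "2 * (2 * real k / \<epsilon> + real k) - w j \<le> ALG A ?I (exits (M - {j}))"
    using ALG_ge_if_visits_all [OF j visits] sum by simp
  have "j \<noteq> z"
  proof
    assume "j = z"
    then have "ALG A ?I (exits (M - {j})) < (1 + \<epsilon>) * w z"
      using assms(4) [OF inst [OF j]] OPT_inst [OF j] prediction_error_inst [OF z j] w_pos [OF z]
      by simp
    also have "(1 + \<epsilon>) * w z = 2 * real k / \<epsilon> + 2 * real k"
      using assms(2) by (simp add: w_def field_simps)
    finally show False
      using cost \<open>j = z\<close> by (simp add: w_def)
  qed
  then have "w j = 1" using j by (simp add: w_def)
  then show ?thesis
    using inst [OF j] prediction_error_inst [OF z j] \<open>j \<noteq> z\<close> path_disjoint_inst OPT_inst [OF j] cost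
    by (intro exI [of _ ?I] exI [of _ "exits (M - {j})"]) auto
qed

end
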